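(* Let $X$ be an arbitrary bounded metric space, and let $m=\#\lambda\Delta\le\#X$, where $\lambda\Delta$ is a simplex all of whose non-zero distances equal $\lambda>0$. Then $$ 2d_{GH}(\lambda\Delta,X)=\max\Bigl\{\operatorname{diam} X-\lambda,\ \inf_{(\alpha,d)\in \operatorname{Ext}_m(X)}h_{\alpha,d}(\lambda)\Bigr\}. $$
   Context: $|xy|$ denotes the distance between points $x,y$ of a metric space, and $\#X$ is the cardinality of $X$ (possibly infinite). A simplex is a metric space all of whose non-zero distances are the same; $\lambda\Delta$ denotes a simplex all of whose non-zero distances equal $\lambda>0$. Gromov--Hausdorff distance: for non-empty subsets $A,B$ of a metric space $Z$, the Hausdorff distance is $d_H(A,B)=\inf\{r>0: A\subset U_r(B),\ B\subset U_r(A)\}$, where $U_r(A)$ is the union of the open balls of radius $r$ centered at the points of $A$. For metric spaces $X,Y$, $d_{GH}(X,Y)$ is the infimum of the real numbers $r$ for which there exist a metric space $Z$ and subsets $X',Y'\subset Z$ isometric to $X$ and $Y$ respectively such that $d_H(X',Y')\le r$. For a cardinal number $m\le\#X$, $\mathcal{D}_m(X)$ is the family of all possible partitions of $X$ into $m$ (non-empty, pairwise disjoint) subsets. For non-empty $A,B\subset X$ put $|AB|=\inf\{|ab|:a\in A,\ b\in B\}$. For $D=\{X_i\}_{i\in I}\in\mathcal{D}_m(X)$ put $\operatorname{diam} D=\sup_{i\in I}\operatorname{diam} X_i$ and $\alpha(D)=\inf\{|X_iX_j|: i\ne j\}$. Let $\mathcal{AD}_m(X)=\{(\alpha(D),\operatorname{diam}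 D): D\in\mathcal{D}_m(X)\}\subset\mathbb{R}^2$ (the pairs are considered as points of the plane) and let $\overline{\mathcal{AD}}_m(X)$ be its closure. A point $(\alpha,d)\in\overline{\mathcal{AD}}_m(X)$ is called extreme if there is no other point $(\alpha',d')\in\overline{\mathcal{AD}}_m(X)$, $(\alpha',d')\neq(\alpha,d)$, such that $\alpha'\ge\alpha$ and $d'\le d$. $\operatorname{Ext}_m(X)$ is the set of all extreme points of $\overline{\mathcal{AD}}_m(X)$. Finally, $h_{\alpha,d}(\lambda)=\max\{d,\ \lambda-\alpha\}$. *)

theory Defs
  imports "HOL-Analysis.Analysis" "HOL-Library.Disjoint_Sets" "HOL-Library.Equipollence"
begin

text \<open>
  Suprema, infima and distances are taken in the extended reals, so that none of them
  depends on the unspecified value of \<open>Inf\<close> or \<open>Sup\<close> on empty or unbounded sets of reals.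
\<close>

section \<open>Hausdorff and Gromov--Hausdorff distance\<close>

definition nbhd :: "'a metric \<Rightarrow> real \<Rightarrow> 'a set \<Rightarrow> 'a set" where
  "nbhd Z r A = (\<Union>a\<in>A. mball_of Z a r)"

definition hausdorff_dist :: "'a metric \<Rightarrow> 'a set \<Rightarrow> 'a set \<Rightarrow> ereal" where
  "hausdorff_dist Z A B = Inf {ereal r | r. 0 < r \<and> A \<subseteq> nbhd Z r B \<and> B \<subseteq> nbhd Z r A}"

definition isometric_copy :: "'a metric \<Rightarrow> 'c metric \<Rightarrow> 'c set \<Rightarrow> bool" where
  "isometric_copy X Z X' \<longleftrightarrow> X' \<subseteq> mspace Z \<and>
     (\<exists>f. bij_betw f (mspace X) X' \<and>
          (\<forall>x\<in>mspace X. \<forall>y\<in>mspace X. mdist Z (f x) (f y) = mdist X x y))"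

definition gh_realized_in :: "'c metric \<Rightarrow> 'a metric \<Rightarrow> 'b metric \<Rightarrow> real \<Rightarrow> bool" where
  "gh_realized_in Z X Y r \<longleftrightarrow>
     (\<exists>X' Y'. isometric_copy X Z X' \<and> isometric_copy Y Z Y' \<and> hausdorff_dist Z X' Y' \<le> ereal r)"

text \<open>
  HOL cannot quantify over the type of the points of the ambient space \<open>Z\<close>. The carrier type
  \<open>'a + 'b\<close> loses nothing, because \<open>Z\<close> may be replaced by the union of the two copies; see
  \<open>gh_realized_in_sum\<close> below.
\<close>

definition gh_dist :: "'a metric \<Rightarrow> 'b metric \<Rightarrow> ereal" where
  "gh_dist X Y = Inf {ereal r | r. \<exists>Z :: ('a + 'b) metric. gh_realized_in Z X Y r}"

lemma subset_nbhd_iff: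
  assumes "A \<subseteq> mspace Z" "B \<subseteq> mspace Z"
  shows "A \<subseteq> nbhd Z r B \<longleftrightarrow> (\<forall>a\<in>A. \<exists>b\<in>B. mdist Z b a < r)"
  using assms unfolding nbhd_def by (auto simp: subset_iff)

lemma gh_realized_in_sum:
  fixes Z :: "'c metric" and X :: "'a metric" and Y :: "'b metric"
  assumes "gh_realized_in Z X Y r"
  shows "\<exists>Z' :: ('a + 'b) metric. gh_realized_in Z' X Y r"
proof -
  obtain X' Y' f h where X': "X' \<subseteq> mspace Z" and Y': "Y' \<subseteq> mspace Z"
    and f: "bij_betw f (mspace X) X'" and h: "bij_betw h (mspace Y) Y'"
    and fd: "\<forall>x\<in>mspace X. \<forall>y\<in>mspace X. mdist Z (f x) (f y) = mdist X x y"
    and hd: "\<forall>x\<in>mspace Y. \<forall>y\<in>mspace Y. mdist Z (h x) (h y) = mdist Y x y"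
    and H: "hausdorff_dist Z X' Y' \<le> ereal r"
    using assms unfolding gh_realized_in_def isometric_copy_def by blast
  define W where "W = X' \<union> Y'"
  define g :: "'c \<Rightarrow> 'a + 'b" where
    "g w = (if w \<in> X' then Inl (inv_into (mspace X) f w) else Inr (inv_into (mspace Y) h w))" for w
  have g: "inj_on g W"
  proof (rule inj_onI)
    fix u v assume uv: "u \<in> W" "v \<in> W" "g u = g v"
    have "f (inv_into (mspace X) f w) = w" if "w \<in> X'" for w
      using f that by (simp add: bij_betw_def f_inv_into_f)
    moreover have "h (inv_into (mspace Y) h w) = w" if "w \<in> Y'" for w
      using h that by (simp add: bij_betw_def f_inv_into_f)
    ultimately show "u = v"
      using uv unfolding W_def g_def by (cases "u \<in> X'"; cases "v \<in> X'") (simp, metis, simp_all, metis)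
  qed
  define k where "k = inv_into W g"
  have k: "k (g w) = w" if "w \<in> W" for w
    using g that by (simp add: k_def)
  define d where "d u v = mdist Z (k u) (k v)" for u v
  have W: "W \<subseteq> mspace Z" using X' Y' by (auto simp: W_def)
  interpret Z: Metric_space "mspace Z" "mdist Z" by simp
  interpret Z': Metric_space "g ` W" d
  proof
    show "d x y = d y x" for x y by (simp add: d_def mdist_commute)
    show "(d x y = 0) = (x = y)" if "x \<in> g ` W" "y \<in> g ` W" for x y
      using that W k by (auto simp: d_def subset_iff)
    show "d x z \<le> d x y + d y z" if "x \<in> g ` W" "y \<in> g ` W" "z \<in> g ` W" for x y z
      using that W k by (auto simp: d_def subset_iff intro!: Z.triangle)
  qed (simp add: d_def)
  define Z' where "Z' = metric (g ` W, d)"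
  have ms: "mspace Z' = g ` W" and md: "mdist Z' = d"
    by (simp_all add: Z'_def)
  have dg: "mdist Z' (g u) (g v) = mdist Z u v" if "u \<in> W" "v \<in> W" for u v
    using that by (simp add: md d_def k)
  have sub: "X' \<subseteq> W" "Y' \<subseteq> W" by (auto simp: W_def)
  have nb: "g ` A \<subseteq> nbhd Z' s (g ` B) \<longleftrightarrow> A \<subseteq> nbhd Z s B" if "A \<subseteq> W" "B \<subseteq> W" for A B s
  proof -
    have "g ` A \<subseteq> nbhd Z' s (g ` B) \<longleftrightarrow> (\<forall>a\<in>A. \<exists>b\<in>B. mdist Z' (g b) (g a) < s)"
      using that subset_nbhd_iff[of "g ` A" Z' "g ` B" s] by (auto simp: ms)
    also have "\<dots> \<longleftrightarrow> (\<forall>a\<in>A. \<exists>b\<in>B. mdist Z b a < s)"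
      by (intro ball_cong bex_cong refl) (use that dg in \<open>auto simp: subset_iff\<close>)
    also have "\<dots> \<longleftrightarrow> A \<subseteq> nbhd Z s B"
      using that W subset_nbhd_iff[of A Z B s] by auto
    finally show ?thesis .
  qed
  have "hausdorff_dist Z' (g ` X') (g ` Y') = hausdorff_dist Z X' Y'"
    unfolding hausdorff_dist_def using nb sub by presburger
  moreover have "isometric_copy X Z' (g ` X')"
    unfolding isometric_copy_def
  proof (intro conjI exI[of _ "g \<circ> f"] ballI)
    show "g ` X' \<subseteq> mspace Z'" using sub ms by auto
    show "bij_betw (g \<circ> f) (mspace X) (g ` X')"
      using bij_betw_trans[OF f] inj_on_imp_bij_betw[OF inj_on_subset[OF g]] sub by blast
    show "mdist Z' ((g \<circ> f) x) ((g \<circ> f) y) = mdist X x y"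
      if "x \<in> mspace X" "y \<in> mspace X" for x y
    proof -
      have "f x \<in> W" "f y \<in> W" using f sub that by (auto simp: bij_betw_def)
      then show ?thesis using fd that by (simp add: dg)
    qed
  qed
  moreover have "isometric_copy Y Z' (g ` Y')"
    unfolding isometric_copy_def
  proof (intro conjI exI[of _ "g \<circ> h"] ballI)
    show "g ` Y' \<subseteq> mspace Z'" using sub ms by auto
    show "bij_betw (g \<circ> h) (mspace Y) (g ` Y')"
      using bij_betw_trans[OF h] inj_on_imp_bij_betw[OF inj_on_subset[OF g]] sub by blast
    show "mdist Z' ((g \<circ> h) x) ((g \<circ> h) y) = mdist Y x y"
      if "x \<in> mspace Y" "y \<in> mspace Y" for x y
    proof -
      have "h x \<in> W" "h y \<in> W" using h sub that by (auto simp: bij_betw_def)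
      then show ?thesis using hd that by (simp add: dg)
    qed
  qed
  ultimately show ?thesis
    unfolding gh_realized_in_def
    by (intro exI[of _ Z'] exI[of _ "g ` X'"] exI[of _ "g ` Y'"] conjI) (simp_all add: H)
qed


section \<open>Simplexes\<close>

definition simplex_metric :: "real \<Rightarrow> 'a metric \<Rightarrow> bool" where
  "simplex_metric lam S \<longleftrightarrow>
     (\<forall>x\<in>mspace S. \<forall>y\<in>mspace S. mdist S x y \<noteq> 0 \<longrightarrow> mdist S x y = lam)"


section \<open>Partitions and their extreme points\<close>

text \<open>A cardinal number \<open>m\<close> is represented by any set \<open>M\<close> of that cardinality.\<close>

definition partitions :: "'b set \<Rightarrow> 'a metric \<Rightarrow> 'a set set set" where
  "partitions M X = {D. partition_on (mspace X) D \<and> D \<approx> M}"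

definition mdiam :: "'a metric \<Rightarrow> 'a set \<Rightarrow> ereal" where
  "mdiam X A = (SUP a\<in>A. SUP b\<in>A. ereal (mdist X a b))"

definition set_gap :: "'a metric \<Rightarrow> 'a set \<Rightarrow> 'a set \<Rightarrow> ereal" where
  "set_gap X A B = (INF a\<in>A. INF b\<in>B. ereal (mdist X a b))"

definition part_diam :: "'a metric \<Rightarrow> 'a set set \<Rightarrow> ereal" where
  "part_diam X D = (SUP A\<in>D. mdiam X A)"

text \<open>
  For the partition into one part the infimum below is over the empty set, so \<open>part_alpha\<close> is
  \<open>\<infinity>\<close>. This is the only reason why the plane has to be extended: for a bounded space and at
  least two parts, \<open>AD\<close>, its closure and \<open>Ext\<close> lie in the ordinary plane and agree with what
  one obtains there; see \<open>AD_Ext_real_plane\<close> below.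
\<close>

definition part_alpha :: "'a metric \<Rightarrow> 'a set set \<Rightarrow> ereal" where
  "part_alpha X D = Inf {set_gap X A B | A B. A \<in> D \<and> B \<in> D \<and> A \<noteq> B}"

definition AD :: "'b set \<Rightarrow> 'a metric \<Rightarrow> (ereal \<times> ereal) set" where
  "AD M X = {(part_alpha X D, part_diam X D) | D. D \<in> partitions M X}"

definition extreme_points :: "('p::order \<times> 'q::order) set \<Rightarrow> ('p \<times> 'q) set" where
  "extreme_points S = {(\<alpha>, d). (\<alpha>, d) \<in> S \<and>
     \<not> (\<exists>\<alpha>' d'. (\<alpha>', d') \<in> S \<and> (\<alpha>', d') \<noteq> (\<alpha>, d) \<and> \<alpha>' \<ge> \<alpha> \<and> d' \<le> d)}"

definition Ext :: "'b set \<Rightarrow> 'a metric \<Rightarrow> (ereal \<times> ereal) set" where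
  "Ext M X = extreme_points (closure (AD M X))"

definition h_fun :: "ereal \<Rightarrow> ereal \<Rightarrow> real \<Rightarrow> ereal" where
  "h_fun \<alpha> d lam = max d (ereal lam - \<alpha>)"

lemma AD_Ext_real_plane:
  fixes X :: "'a metric" and M :: "'b set"
  assumes bdd: "Metric_space.mbounded (mspace X) (mdist X) (mspace X)"
    and two: "p \<in> M" "q \<in> M" "p \<noteq> q"
  defines "e \<equiv> map_prod ereal ereal"
  defines "P \<equiv> e -` AD M X"
  shows "AD M X = e ` P" "closure (AD M X) = e ` closure P" "Ext M X = e ` extreme_points (closure P)"
proof -
  obtain B0 where B0: "\<And>x y. x \<in> mspace X \<Longrightarrow> y \<in> mspace X \<Longrightarrow> mdist X x y \<le> B0"
    using bdd by (auto simp: Metric_space.mbounded_alt)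
  have box: "AD M X \<subseteq> {0..ereal B0} \<times> {0..ereal B0}"
  proof clarify
    fix \<alpha> d assume "(\<alpha>, d) \<in> AD M X"
    then obtain D where D: "partition_on (mspace X) D" "D \<approx> M"
      and eq: "\<alpha> = part_alpha X D" "d = part_diam X D"
      by (auto simp: AD_def partitions_def)
    obtain g where g: "bij_betw g M D" using D(2) eqpoll_sym eqpoll_def by blast
    define A where "A = g p"
    define B where "B = g q"
    have AB: "A \<in> D" "B \<in> D" "A \<noteq> B"
      using g two by (auto simp: bij_betw_def A_def B_def inj_on_def)
    have sub: "C \<subseteq> mspace X" "C \<noteq> {}" if "C \<in> D" for C
      using D(1) that by (auto simp: partition_on_def)
    obtain a b where ab: "a \<in> A" "b \<in> B" using sub AB by blast
    have abX: "a \<in> mspace X" "b \<in> mspace X" using ab sub AB by blast+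
    have "part_alpha X D \<le> set_gap X A B"
      unfolding part_alpha_def using AB by (intro Inf_lower) blast
    also have "\<dots> \<le> (INF b\<in>B. ereal (mdist X a b))"
      unfolding set_gap_def using ab by (intro INF_lower)
    also have "\<dots> \<le> ereal (mdist X a b)" using ab by (intro INF_lower)
    also have "\<dots> \<le> ereal B0" using B0 abX by simp
    finally have 1: "\<alpha> \<le> ereal B0" by (simp add: eq)
    have 2: "0 \<le> \<alpha>"
      unfolding eq part_alpha_def set_gap_def by (auto intro!: Inf_greatest INF_greatest)
    have 3: "d \<le> ereal B0"
      unfolding eq part_diam_def mdiam_def using B0 sub by (intro SUP_least) auto
    have "0 \<le> ereal (mdist X a a)" by simp
    also have "\<dots> \<le> (SUP b\<in>A. ereal (mdist X a b))" using ab by (intro SUP_upper)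
    also have "\<dots> \<le> mdiam X A" unfolding mdiam_def
      using ab(1) by (rule SUP_upper[where f="\<lambda>a. SUP b\<in>A. ereal (mdist X a b)"])
    also have "\<dots> \<le> d" unfolding eq part_diam_def using AB by (intro SUP_upper)
    finally have 4: "0 \<le> d" .
    show "\<alpha> \<in> {0..ereal B0} \<and> d \<in> {0..ereal B0}" using 1 2 3 4 by simp
  qed
  have rng: "\<exists>u v. x = e (u, v) \<and> (u, v) \<in> {0..B0} \<times> {0..B0}"
    if "x \<in> {0..ereal B0} \<times> {0..ereal B0}" for x
  proof -
    obtain \<alpha> d where x: "x = (\<alpha>, d)" by fastforce
    then show ?thesis using that unfolding e_def by (cases \<alpha>; cases d) auto
  qed
  show 1: "AD M X = e ` P"
  proof
    show "AD M X \<subseteq> e ` P"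
    proof
      fix x assume x: "x \<in> AD M X"
      then obtain u v where "x = e (u, v)" using rng box by blast
      then show "x \<in> e ` P" using x by (simp add: P_def)
    qed
  qed (auto simp: P_def)
  have "P \<subseteq> {0..B0} \<times> {0..B0}"
    using box unfolding P_def e_def by auto
  then have "bounded P"
    by (rule bounded_subset[rotated]) (intro bounded_Times bounded_closed_interval)
  then have cP: "compact (closure P)" by simp
  have cont: "continuous_on S e" for S
  proof -
    have "continuous_on S (\<lambda>z. (ereal (fst z), ereal (snd z)))"
      by (intro continuous_on_Pair continuous_on_ereal continuous_on_fst continuous_on_snd
          continuous_on_id)
    moreover have "e = (\<lambda>z. (ereal (fst z), ereal (snd z)))" by (auto simp: e_def)
    ultimately show ?thesis by simp
  qed
  show 2: "closure (AD M X) = e ` closure P"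
  proof
    have "closed (e ` closure P)"
      by (intro compact_imp_closed compact_continuous_image cont cP)
    then show "closure (AD M X) \<subseteq> e ` closure P"
      unfolding 1 by (intro closure_minimal image_mono closure_subset)
    show "e ` closure P \<subseteq> closure (AD M X)"
      unfolding 1 by (intro image_closure_subset cont) (auto simp: closure_subset)
  qed
  show "Ext M X = e ` extreme_points (closure P)"
  proof -
    have mem: "(\<alpha>, d) \<in> e ` T \<longleftrightarrow> (\<exists>u v. \<alpha> = ereal u \<and> d = ereal v \<and> (u, v) \<in> T)" for \<alpha> d T
      unfolding e_def by force
    have all: "(\<forall>\<alpha> d. (\<alpha>, d) \<in> e ` T \<longrightarrow> Q \<alpha> d) \<longleftrightarrow> (\<forall>u v. (u, v) \<in> T \<longrightarrow> Q (ereal u) (ereal v))" for T Q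
      unfolding mem by blast
    have "extreme_points (e ` T) = e ` extreme_points T" for T
    proof -
      have E: "(\<alpha>, d) \<in> extreme_points U \<longleftrightarrow> (\<alpha>, d) \<in> U \<and>
          (\<forall>\<alpha>' d'. (\<alpha>', d') \<in> U \<longrightarrow> \<alpha> \<le> \<alpha>' \<longrightarrow> d' \<le> d \<longrightarrow> \<alpha>' = \<alpha> \<and> d' = d)"
        for U :: "('p::order \<times> 'q::order) set" and \<alpha> d
        unfolding extreme_points_def by auto
      have "(\<alpha>, d) \<in> extreme_points (e ` T) \<longleftrightarrow> (\<alpha>, d) \<in> e ` extreme_points T" for \<alpha> d
      proof (cases "(\<alpha>, d) \<in> e ` T")
        case False
        then have "(\<alpha>, d) \<notin> e ` extreme_points T" by (auto simp: extreme_points_def)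
        then show ?thesis using False by (simp add: E)
      next
        case True
        then obtain u v where uv: "\<alpha> = ereal u" "d = ereal v" "(u, v) \<in> T"
          unfolding mem by blast
        have "(\<alpha>, d) \<in> e ` extreme_points T \<longleftrightarrow> (u, v) \<in> extreme_points T"
          unfolding mem uv by simp
        also have "\<dots> \<longleftrightarrow> (\<forall>u' v'. (u', v') \<in> T \<longrightarrow> u \<le> u' \<longrightarrow> v' \<le> v \<longrightarrow> u' = u \<and> v' = v)"
          using uv(3) by (simp add: E)
        also have "\<dots> \<longleftrightarrow> (\<forall>\<alpha>' d'. (\<alpha>', d') \<in> e ` T \<longrightarrow> \<alpha> \<le> \<alpha>' \<longrightarrow> d' \<le> d \<longrightarrow> \<alpha>' = \<alpha> \<and> d' = d)"
          unfolding all uv(1,2) by simp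
        also have "\<dots> \<longleftrightarrow> (\<alpha>, d) \<in> extreme_points (e ` T)"
          using True by (simp add: E)
        finally show ?thesis by simp
      qed
      then show ?thesis by (intro set_eqI) (simp only: split_paired_all)
    qed
    then show ?thesis unfolding Ext_def 2 .
  qed
qed

end

theory Submission
  imports Defs
begin

text \<open>
  Both sides of the identity measure how well \<open>X\<close> can be labelled by the points of the simplex
  \<open>S\<close>. A partition of \<open>X\<close> into \<open>#S\<close> parts is the family of fibres of a map \<open>s\<close> from \<open>X\<close> onto \<open>S\<close>.
  Two points in the same fibre have images at distance 0 and two points in different fibres have
  images at distance \<open>lam\<close>, so the distortion of \<open>s\<close> is at most \<open>c\<close> exactly when the diameters of
  the fibres and \<open>lam\<close> minus the gap between them are at most \<open>c\<close> and \<open>diam X - lam \<le> c\<close>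
  (\<open>fibres_bound_iff_distortion_le\<close>). Hence the maximum of \<open>diam X - lam\<close> and of the infimum of
  \<open>h\<close> over all pairs in \<open>AD\<close> is the infimal distortion of maps from \<open>X\<close> onto \<open>S\<close>.

  Replacing \<open>AD\<close> by \<open>Ext\<close> changes nothing (\<open>INF_Ext_eq_INF_AD\<close>): the superlevel sets of \<open>h\<close> are
  closed, so passing to the closure keeps the infimum; and in a compact set every point lies below
  an extreme one in the order for which \<open>h\<close> is decreasing.

  It remains to see that the infimal distortion is \<open>2 d\<^sub>G\<^sub>H\<close>. A surjection of distortion \<open>2 r\<close> lets one
  glue the two spaces along it at distance \<open>r\<close> (\<open>gh_dist_le_of_surjection\<close>). Conversely, copies at
  Hausdorff distance less than \<open>r\<close> give a correspondence of distortion less than \<open>2 r\<close>, and a map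
  \<open>q\<close> from \<open>X\<close> to \<open>S\<close> selected from it (\<open>surjection_of_gh_realized_in\<close>). If \<open>2 r \<le> lam\<close>, no point of \<open>X\<close>
  corresponds to two vertices, so \<open>q\<close> is onto. If \<open>2 r > lam\<close>, the map \<open>q\<close> may miss vertices, but
  then the gap between the fibres is irrelevant because \<open>lam - \<alpha> \<le> lam < 2 r\<close>, and since
  \<open>#S \<le> #X\<close> the fibres can be cut into exactly \<open>#S\<close> smaller parts (\<open>surjection_refining\<close>).
\<close>

section \<open>Extreme points of compact sets\<close>

text \<open>
  Maximising the first coordinate over the points of \<open>K\<close> above \<open>(\<alpha>, d)\<close>, and then minimising the
  second one among the maximisers, leaves no room for improvement in either coordinate.
\<close>

lemma extreme_point_above:
  fixes K :: "('p::linorder_topology \<times> 'q::linorder_topology) set"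
  assumes K: "compact K" and p: "(\<alpha>, d) \<in> K"
  shows "\<exists>\<alpha>' d'. (\<alpha>', d') \<in> extreme_points K \<and> \<alpha> \<le> \<alpha>' \<and> d' \<le> d"
proof -
  define K1 where "K1 = K \<inter> ({q. \<alpha> \<le> fst q} \<inter> {q. snd q \<le> d})"
  have "compact K1"
    unfolding K1_def
    by (intro compact_Int_closed[OF K] closed_Int closed_Collect_le continuous_intros)
  moreover have "(\<alpha>, d) \<in> K1" using p by (simp add: K1_def)
  ultimately obtain q where q: "q \<in> K1" and qmax: "\<And>y. y \<in> K1 \<Longrightarrow> fst y \<le> fst q"
    using continuous_attains_sup[of K1 fst] continuous_on_fst[OF continuous_on_id] by blast
  define K2 where "K2 = K1 \<inter> {y. fst q \<le> fst y}"
  have "compact K2"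
    unfolding K2_def
    by (intro compact_Int_closed[OF \<open>compact K1\<close>] closed_Collect_le continuous_intros)
  moreover have "q \<in> K2" using q by (simp add: K2_def)
  ultimately obtain w where w: "w \<in> K2" and wmin: "\<And>y. y \<in> K2 \<Longrightarrow> snd w \<le> snd y"
    using continuous_attains_inf[of K2 snd] continuous_on_snd[OF continuous_on_id] by blast
  obtain \<alpha>' d' where w': "w = (\<alpha>', d')" by fastforce
  have in': "(\<alpha>', d') \<in> K" "\<alpha> \<le> \<alpha>'" "d' \<le> d" "fst q \<le> \<alpha>'"
    using w unfolding w' K2_def K1_def by auto
  have "\<alpha>'' = \<alpha>' \<and> d'' = d'"
    if "(\<alpha>'', d'') \<in> K" "\<alpha>' \<le> \<alpha>''" "d'' \<le> d'" for \<alpha>'' d''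
  proof -
    have "(\<alpha>'', d'') \<in> K1" using that in' by (auto simp: K1_def)
    moreover from this have "(\<alpha>'', d'') \<in> K2" using that in' by (auto simp: K2_def)
    ultimately show ?thesis using qmax wmin that in' unfolding w' by fastforce
  qed
  then have "(\<alpha>', d') \<in> extreme_points K"
    using in' unfolding extreme_points_def by blast
  then show ?thesis using in' by blast
qed

lemma compact_closure_AD: "compact (closure (AD M X))"
proof -
  have "compact (UNIV \<times> UNIV :: (ereal \<times> ereal) set)"
    by (intro compact_Times compact_UNIV)
  then have "compact (UNIV \<inter> closure (AD M X))"
    by (intro compact_Int_closed) simp_all
  then show ?thesis by simp
qed

text \<open>
  With \<open>\<alpha>\<close> alone on one side of its inequality, the superlevel sets of \<open>h\<close> are visibly closed, also
  at the infinite values of \<open>\<alpha>\<close>.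
\<close>

lemma h_fun_ge_iff: "c \<le> h_fun \<alpha> d lam \<longleftrightarrow> c \<le> d \<or> \<alpha> \<le> ereal lam - c"
  unfolding h_fun_def le_max_iff_disj by (cases c; cases \<alpha>) auto

lemma INF_Ext_eq_INF_AD:
  "(INF (\<alpha>, d) \<in> Ext M X. h_fun \<alpha> d lam) = (INF (\<alpha>, d) \<in> AD M X. h_fun \<alpha> d lam)"
  (is "?E = ?A")
proof (rule antisym)
  let ?C = "{q. ?A \<le> snd q} \<union> {q. fst q \<le> ereal lam - ?A}"
  have "q \<in> ?C" if "q \<in> AD M X" for q
  proof -
    have "?A \<le> h_fun (fst q) (snd q) lam"
      using INF_lower[OF that, of "\<lambda>(\<alpha>, d). h_fun \<alpha> d lam"] by (simp add: case_prod_unfold)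
    then show ?thesis by (simp add: h_fun_ge_iff)
  qed
  then have "closure (AD M X) \<subseteq> ?C"
    by (intro closure_minimal closed_Un closed_Collect_le continuous_intros) auto
  then have "?A \<le> h_fun \<alpha> d lam" if "(\<alpha>, d) \<in> Ext M X" for \<alpha> d
    using that unfolding h_fun_ge_iff Ext_def extreme_points_def by force
  then show "?A \<le> ?E" by (intro INF_greatest) auto
  have "?E \<le> h_fun \<alpha> d lam" if "(\<alpha>, d) \<in> AD M X" for \<alpha> d
  proof -
    have "(\<alpha>, d) \<in> closure (AD M X)" using that closure_subset by blast
    from extreme_point_above[OF compact_closure_AD this]
    obtain \<alpha>' d' where e: "(\<alpha>', d') \<in> Ext M X" "\<alpha> \<le> \<alpha>'" "d' \<le> d"
      unfolding Ext_def by blast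
    have "?E \<le> h_fun \<alpha>' d' lam"
      using INF_lower[OF e(1), of "\<lambda>(\<alpha>, d). h_fun \<alpha> d lam"] by simp
    also have "\<dots> \<le> h_fun \<alpha> d lam"
      unfolding h_fun_def using e by (intro max.mono ereal_minus_mono) auto
    finally show ?thesis .
  qed
  then show "?E \<le> ?A" by (intro INF_greatest) auto
qed

section \<open>Partitions as fibres of labellings\<close>

text \<open>Indexing by \<open>s ` A\<close> rather than by the whole codomain keeps the empty fibres out.\<close>

definition fibres :: "('a \<Rightarrow> 'b) \<Rightarrow> 'a set \<Rightarrow> 'a set set" where
  "fibres s A = (\<lambda>t. {x \<in> A. s x = t}) ` s ` A"

text \<open>
  A bijection from the set of parts onto \<open>M\<close>, composed with the map sending a point to its part,
  labels the points; the converse holds because distinct labels have distinct nonempty fibres.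
\<close>

lemma partitions_eq_fibres:
  "partitions M X = {fibres s (mspace X) | s. s ` mspace X = M}"
proof (intro set_eqI iffI)
  fix D assume "D \<in> partitions M X"
  then obtain g where D: "partition_on (mspace X) D" and g: "bij_betw g D M"
    by (auto simp: partitions_def eqpoll_def)
  define part where "part x = (THE A. A \<in> D \<and> x \<in> A)" for x
  have part: "part x = A" if "A \<in> D" "x \<in> A" for x A
    unfolding part_def using that partition_onD2[OF D]
    by (intro the_equality) (auto simp: disjoint_def)
  have ne: "A \<noteq> {}" "A \<subseteq> mspace X" if "A \<in> D" for A
    using D that by (auto simp: partition_on_def)
  have part_in: "part x \<in> D" "x \<in> part x" if x: "x \<in> mspace X" for x
  proof -
    obtain A where "A \<in> D" "x \<in> A" using D x by (auto simp: partition_on_def)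
    then show "part x \<in> D" "x \<in> part x" using part by auto
  qed
  have im: "part ` mspace X = D"
    using part part_in ne by (auto simp: image_iff) (metis equals0I subsetD)
  have "{x \<in> mspace X. g (part x) = g (part y)} = part y" if "y \<in> mspace X" for y
  proof -
    have "g (part x) = g (part y) \<longleftrightarrow> part x = part y" if "x \<in> mspace X" for x
      using inj_on_eq_iff[OF bij_betw_imp_inj_on[OF g] part_in(1) part_in(1)] that
        \<open>y \<in> mspace X\<close> by simp
    moreover have "x \<in> mspace X \<and> part x = part y \<longleftrightarrow> x \<in> part y" for x
      using part part_in ne that by (metis subsetD)
    ultimately show ?thesis by blast
  qed
  then have "fibres (g \<circ> part) (mspace X) = part ` mspace X"
    unfolding fibres_def image_image by (intro image_cong) auto
  moreover have "(g \<circ> part) ` mspace X = M"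
    using g im by (metis bij_betw_imp_surj_on image_comp)
  ultimately show "D \<in> {fibres s (mspace X) | s. s ` mspace X = M}" using im by blast
next
  fix D assume "D \<in> {fibres s (mspace X) | s. s ` mspace X = M}"
  then obtain s where s: "s ` mspace X = M" and D: "D = fibres s (mspace X)" by blast
  have "partition_on (mspace X) D"
    unfolding D fibres_def by (rule partition_onI) (auto simp: disjnt_def)
  moreover have "inj_on (\<lambda>t. {x \<in> mspace X. s x = t}) M"
    unfolding s[symmetric] by (rule inj_onI) blast
  then have "D \<approx> M"
    unfolding D fibres_def s by (rule inj_on_image_eqpoll_self)
  ultimately show "D \<in> partitions M X" by (simp add: partitions_def)
qed

lemma mdiam_le_iff:
  "mdiam X A \<le> c \<longleftrightarrow> (\<forall>x\<in>A. \<forall>y\<in>A. ereal (mdist X x y) \<le> c)"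
  unfolding mdiam_def by (simp add: SUP_le_iff)

lemma part_diam_fibres_le_iff:
  "part_diam X (fibres s A) \<le> c \<longleftrightarrow>
    (\<forall>x\<in>A. \<forall>y\<in>A. s x = s y \<longrightarrow> ereal (mdist X x y) \<le> c)"
  unfolding part_diam_def fibres_def SUP_le_iff mdiam_le_iff by auto

lemma le_part_alpha_fibres_iff:
  "c \<le> part_alpha X (fibres s A) \<longleftrightarrow>
    (\<forall>x\<in>A. \<forall>y\<in>A. s x \<noteq> s y \<longrightarrow> c \<le> ereal (mdist X x y))"
proof -
  have "c \<le> part_alpha X (fibres s A) \<longleftrightarrow>
      (\<forall>P \<in> fibres s A. \<forall>Q \<in> fibres s A. P \<noteq> Q \<longrightarrow> c \<le> set_gap X P Q)"
    unfolding part_alpha_def le_Inf_iff by blast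
  also have "\<dots> \<longleftrightarrow> (\<forall>P \<in> fibres s A. \<forall>Q \<in> fibres s A. P \<noteq> Q \<longrightarrow>
      (\<forall>x\<in>P. \<forall>y\<in>Q. c \<le> ereal (mdist X x y)))"
    unfolding set_gap_def le_INF_iff ..
  also have "\<dots> \<longleftrightarrow> (\<forall>x\<in>A. \<forall>y\<in>A. s x \<noteq> s y \<longrightarrow> c \<le> ereal (mdist X x y))"
  proof (intro iffI ballI impI)
    fix x y
    assume *: "\<forall>P\<in>fibres s A. \<forall>Q\<in>fibres s A. P \<noteq> Q \<longrightarrow>
        (\<forall>x\<in>P. \<forall>y\<in>Q. c \<le> ereal (mdist X x y))"
      and xy: "x \<in> A" "y \<in> A" "s x \<noteq> s y"
    let ?P = "{z \<in> A. s z = s x}" and ?Q = "{z \<in> A. s z = s y}"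
    have "?P \<in> fibres s A" "?Q \<in> fibres s A" "?P \<noteq> ?Q" "x \<in> ?P" "y \<in> ?Q"
      using xy by (auto simp: fibres_def)
    from *[rule_format, OF this] show "c \<le> ereal (mdist X x y)" .
  next
    fix P Q x y
    assume *: "\<forall>x\<in>A. \<forall>y\<in>A. s x \<noteq> s y \<longrightarrow> c \<le> ereal (mdist X x y)"
      and PQ: "P \<in> fibres s A" "Q \<in> fibres s A" "P \<noteq> Q" and xy: "x \<in> P" "y \<in> Q"
    have "P = {z \<in> A. s z = s x}" "Q = {z \<in> A. s z = s y}" "x \<in> A" "y \<in> A"
      using PQ(1,2) xy by (auto simp: fibres_def)
    with PQ(3) * show "c \<le> ereal (mdist X x y)" by metis
  qed
  finally show ?thesis .
qed

section \<open>Distortion of labellings by a simplex\<close>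

definition distortion_le :: "'a metric \<Rightarrow> 'b metric \<Rightarrow> ('a \<Rightarrow> 'b) \<Rightarrow> real \<Rightarrow> bool" where
  "distortion_le X Y f c \<longleftrightarrow>
    (\<forall>x\<in>mspace X. \<forall>y\<in>mspace X. \<bar>mdist X x y - mdist Y (f x) (f y)\<bar> \<le> c)"

lemma simplex_mdist:
  assumes "simplex_metric lam S" "s \<in> mspace S" "t \<in> mspace S"
  shows "mdist S s t = (if s = t then 0 else lam)"
  using assms by (auto simp: simplex_metric_def)

text \<open>
  The diameter and the gap of the partition account for the distortion at pairs with equal labels
  and for the lower bound on distances at pairs with distinct labels. What remains is the upper
  bound \<open>mdist X x y \<le> c + lam\<close> at distinct labels. The term \<open>diam X - lam\<close> imposes it at all pairs,
  which costs nothing, because \<open>mdist X x y \<le> c\<close> at equal labels.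
\<close>

lemma fibres_bound_iff_distortion_le:
  assumes lam: "0 < lam" and S: "simplex_metric lam S" and s: "s ` mspace X = mspace S"
  shows "max (mdiam X (mspace X) - ereal lam)
      (h_fun (part_alpha X (fibres s (mspace X))) (part_diam X (fibres s (mspace X))) lam)
      \<le> ereal c \<longleftrightarrow> distortion_le X S s c"
proof -
  let ?F = "fibres s (mspace X)"
  have dS: "mdist S (s x) (s y) = (if s x = s y then 0 else lam)"
    if "x \<in> mspace X" "y \<in> mspace X" for x y
    using that s by (intro simplex_mdist[OF S]) auto
  have 1: "mdiam X (mspace X) - ereal lam \<le> ereal c \<longleftrightarrow>
      (\<forall>x\<in>mspace X. \<forall>y\<in>mspace X. mdist X x y \<le> c + lam)"
    by (simp add: ereal_minus_le mdiam_le_iff)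
  have 2: "part_diam X ?F \<le> ereal c \<longleftrightarrow>
      (\<forall>x\<in>mspace X. \<forall>y\<in>mspace X. s x = s y \<longrightarrow> mdist X x y \<le> c)"
    by (simp add: part_diam_fibres_le_iff)
  have "ereal lam - part_alpha X ?F \<le> ereal c \<longleftrightarrow> ereal (lam - c) \<le> part_alpha X ?F"
    by (cases "part_alpha X ?F") auto
  then have 3: "ereal lam - part_alpha X ?F \<le> ereal c \<longleftrightarrow>
      (\<forall>x\<in>mspace X. \<forall>y\<in>mspace X. s x \<noteq> s y \<longrightarrow> lam - c \<le> mdist X x y)"
    by (simp add: le_part_alpha_fibres_iff)
  have "max (mdiam X (mspace X) - ereal lam) (h_fun (part_alpha X ?F) (part_diam X ?F) lam)
      \<le> ereal c \<longleftrightarrow> (\<forall>x\<in>mspace X. \<forall>y\<in>mspace X. mdist X x y \<le> c + lam \<and>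
        (s x = s y \<longrightarrow> mdist X x y \<le> c) \<and> (s x \<noteq> s y \<longrightarrow> lam - c \<le> mdist X x y))"
    unfolding h_fun_def max.bounded_iff 1 2 3 by blast
  also have "\<dots> \<longleftrightarrow> distortion_le X S s c"
    unfolding distortion_le_def
  proof (intro ball_cong refl)
    fix x y assume xy: "x \<in> mspace X" "y \<in> mspace X"
    from lam mdist_nonneg[of X x y]
    show "(mdist X x y \<le> c + lam \<and> (s x = s y \<longrightarrow> mdist X x y \<le> c) \<and>
        (s x \<noteq> s y \<longrightarrow> lam - c \<le> mdist X x y)) =
        (\<bar>mdist X x y - mdist S (s x) (s y)\<bar> \<le> c)"
      unfolding dS[OF xy] by (cases "s x = s y") (simp_all add: abs_le_iff, linarith+)
  qed
  finally show ?thesis .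
qed

lemma max_INF_Ext_le:
  assumes lam: "0 < lam" and S: "simplex_metric lam S" and s: "s ` mspace X = mspace S"
    and c: "distortion_le X S s c"
  shows "max (mdiam X (mspace X) - ereal lam)
      (INF (\<alpha>, d) \<in> Ext (mspace S) X. h_fun \<alpha> d lam) \<le> ereal c"
proof -
  let ?F = "fibres s (mspace X)"
  have "(part_alpha X ?F, part_diam X ?F) \<in> AD (mspace S) X"
    unfolding AD_def partitions_eq_fibres using s by blast
  from INF_lower[OF this, of "\<lambda>(\<alpha>, d). h_fun \<alpha> d lam"]
  have "max (mdiam X (mspace X) - ereal lam)
      (INF (\<alpha>, d) \<in> Ext (mspace S) X. h_fun \<alpha> d lam)
      \<le> max (mdiam X (mspace X) - ereal lam)
          (h_fun (part_alpha X ?F) (part_diam X ?F) lam)"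
    unfolding INF_Ext_eq_INF_AD by (intro max.mono) simp_all
  also have "\<dots> \<le> ereal c"
    using fibres_bound_iff_distortion_le[OF lam S s] c by blast
  finally show ?thesis .
qed

lemma max_INF_Ext_less:
  assumes lam: "0 < lam" and S: "simplex_metric lam S"
    and c: "max (mdiam X (mspace X) - ereal lam)
      (INF (\<alpha>, d) \<in> Ext (mspace S) X. h_fun \<alpha> d lam) < ereal c"
  shows "\<exists>s. s ` mspace X = mspace S \<and> distortion_le X S s c"
proof -
  have "(INF (\<alpha>, d) \<in> AD (mspace S) X. h_fun \<alpha> d lam) < ereal c"
    using c by (simp add: INF_Ext_eq_INF_AD)
  then obtain \<alpha> d where AD: "(\<alpha>, d) \<in> AD (mspace S) X" and h: "h_fun \<alpha> d lam < ereal c"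
    unfolding INF_less_iff by force
  obtain s where s: "s ` mspace X = mspace S"
    and eq: "\<alpha> = part_alpha X (fibres s (mspace X))" "d = part_diam X (fibres s (mspace X))"
    using AD unfolding AD_def partitions_eq_fibres by blast
  have "mdiam X (mspace X) - ereal lam < ereal c"
    using c by (rule le_less_trans[OF max.cobounded1])
  then have "distortion_le X S s c"
    unfolding fibres_bound_iff_distortion_le[OF lam S s, symmetric] eq[symmetric]
    using h by (intro max.boundedI less_imp_le)
  then show ?thesis using s by blast
qed

section \<open>Gluing along a surjection\<close>

text \<open>
  On the disjoint union, the distance from \<open>y\<close> to \<open>x\<close> is the infimal length of a way that moves in
  \<open>Y\<close> from \<open>y\<close> to some \<open>f u\<close>, jumps to \<open>u\<close> at cost \<open>r\<close>, and moves in \<open>X\<close> from \<open>u\<close> to \<open>x\<close>. Crossing over and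
  back costs two jumps, that is \<open>2 * r\<close>, which pays for the distortion; so no shortcut arises
  between two points of the same space. Positivity of \<open>r\<close> keeps the two copies disjoint.
\<close>

lemma gh_dist_le_of_surjection:
  fixes X :: "'a metric" and Y :: "'b metric"
  assumes X: "mspace X \<noteq> {}" and f: "f ` mspace X = mspace Y"
    and c: "distortion_le X Y f (2 * r)" and r: "0 < r"
  shows "gh_dist Y X \<le> ereal r"
proof -
  have fX: "f u \<in> mspace Y" if "u \<in> mspace X" for u using f that by blast
  define D where "D y x = (INF u\<in>mspace X. mdist Y y (f u) + r + mdist X u x)" for y x
  have bdd: "bdd_below ((\<lambda>u. mdist Y y (f u) + r + mdist X u x) ` mspace X)" for y x
    by (rule bdd_belowI2[of _ 0]) (use r in simp)
  have D_le: "D y x \<le> mdist Y y (f u) + r + mdist X u x" if "u \<in> mspace X" for y x u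
    unfolding D_def using that by (intro cINF_lower bdd)
  have D_ge: "a \<le> D y x" if "\<And>u. u \<in> mspace X \<Longrightarrow> a \<le> mdist Y y (f u) + r + mdist X u x" for a y x
    unfolding D_def using that X by (intro cINF_greatest)
  have D_pos: "r \<le> D y x" for y x by (intro D_ge) simp
  have T1: "D y x \<le> mdist Y y z + D z x"
    if "y \<in> mspace Y" "z \<in> mspace Y" for y z x
  proof -
    have "D y x - mdist Y y z \<le> D z x"
    proof (rule D_ge)
      fix u assume u: "u \<in> mspace X"
      show "D y x - mdist Y y z \<le> mdist Y z (f u) + r + mdist X u x"
        using D_le[OF u, of y x] mdist_triangle[of y Y z "f u"] that fX[OF u] by simp
    qed
    then show ?thesis by simp
  qed
  have T2: "D y x \<le> D y z + mdist X z x"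
    if "x \<in> mspace X" "z \<in> mspace X" for y z x
  proof -
    have "D y x - mdist X z x \<le> D y z"
    proof (rule D_ge)
      fix u assume u: "u \<in> mspace X"
      show "D y x - mdist X z x \<le> mdist Y y (f u) + r + mdist X u z"
        using D_le[OF u, of y x] mdist_triangle[of u X z x] that u by simp
    qed
    then show ?thesis by simp
  qed
  have T3: "mdist Y y z \<le> D y x + D z x"
    if "y \<in> mspace Y" "z \<in> mspace Y" "x \<in> mspace X" for y z x
  proof -
    have "mdist Y y z - D y x \<le> D z x"
    proof (rule D_ge)
      fix v assume v: "v \<in> mspace X"
      have "mdist Y y z - (mdist Y z (f v) + r + mdist X v x) \<le> D y x"
      proof (rule D_ge)
        fix u assume u: "u \<in> mspace X"
        have "mdist Y (f u) (f v) \<le> mdist X u v + 2 * r"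
          using c u v unfolding distortion_le_def by (fastforce simp: abs_le_iff)
        then show "mdist Y y z - (mdist Y z (f v) + r + mdist X v x)
            \<le> mdist Y y (f u) + r + mdist X u x"
          using mdist_triangle[of y Y "f u" z] mdist_triangle[of "f u" Y "f v" z]
            mdist_triangle[of u X x v] that u v fX
          by (simp add: mdist_commute)
      qed
      then show "mdist Y y z - D y x \<le> mdist Y z (f v) + r + mdist X v x" by simp
    qed
    then show ?thesis by simp
  qed
  have T4: "mdist X x z \<le> D y x + D y z"
    if "y \<in> mspace Y" "x \<in> mspace X" "z \<in> mspace X" for y z x
  proof -
    have "mdist X x z - D y x \<le> D y z"
    proof (rule D_ge)
      fix v assume v: "v \<in> mspace X"
      have "mdist X x z - (mdist Y y (f v) + r + mdist X v z) \<le> D y x"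
      proof (rule D_ge)
        fix u assume u: "u \<in> mspace X"
        have "mdist X u v \<le> mdist Y (f u) (f v) + 2 * r"
          using c u v unfolding distortion_le_def by (fastforce simp: abs_le_iff)
        then show "mdist X x z - (mdist Y y (f v) + r + mdist X v z)
            \<le> mdist Y y (f u) + r + mdist X u x"
          using mdist_triangle[of x X u z] mdist_triangle[of u X v z]
            mdist_triangle[of "f u" Y y "f v"] that u v fX
          by (simp add: mdist_commute)
      qed
      then show "mdist X x z - D y x \<le> mdist Y y (f v) + r + mdist X v z" by simp
    qed
    then show ?thesis by simp
  qed
  have T1': "D z x \<le> D y x + mdist Y y z" if "y \<in> mspace Y" "z \<in> mspace Y" for y z x
    using T1[OF that(2,1), of x] by (simp add: mdist_commute add.commute)
  have T2': "D y x \<le> mdist X x z + D y z" if "x \<in> mspace X" "z \<in> mspace X" for y z x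
    using T2[OF that, of y] by (simp add: mdist_commute add.commute)
  define W where "W = Inl ` mspace Y \<union> Inr ` mspace X"
  define dist where "dist p q = (case p of
      Inl y \<Rightarrow> (case q of Inl z \<Rightarrow> mdist Y y z | Inr x \<Rightarrow> D y x)
    | Inr x \<Rightarrow> (case q of Inl y \<Rightarrow> D y x | Inr z \<Rightarrow> mdist X x z))" for p q
  interpret W: Metric_space W dist
  proof
    show "0 \<le> dist p q" for p q
      using D_pos r by (auto simp: dist_def split: sum.split intro: order_trans[of 0 r])
    show "dist p q = dist q p" for p q
      by (auto simp: dist_def mdist_commute split: sum.split)
    show "(dist p q = 0) = (p = q)" if "p \<in> W" "q \<in> W" for p q
    proof -
      have "D y x \<noteq> 0" for y x using D_pos[of y x] r by simp
      then show ?thesis using that by (auto simp: dist_def W_def)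
    qed
    show "dist p w \<le> dist p q + dist q w" if "p \<in> W" "q \<in> W" "w \<in> W" for p q w
      using that T1' T2'
      by (auto simp: dist_def W_def intro: mdist_triangle T1 T2 T3 T4)
  qed
  define Z where "Z = metric (W, dist)"
  have Z: "mspace Z = W" "mdist Z = dist" by (simp_all add: Z_def)
  have cY: "isometric_copy Y Z (Inl ` mspace Y)"
    unfolding isometric_copy_def
    by (intro conjI exI[of _ Inl]) (auto simp: Z W_def dist_def bij_betw_def)
  have cX: "isometric_copy X Z (Inr ` mspace X)"
    unfolding isometric_copy_def
    by (intro conjI exI[of _ Inr]) (auto simp: Z W_def dist_def bij_betw_def)
  have close: "dist (Inl (f x)) (Inr x) \<le> r" if "x \<in> mspace X" for x
  proof -
    have "mdist Y (f x) (f x) = 0" "mdist X x x = 0" using that fX by simp_all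
    with D_le[OF that, of "f x" x] show ?thesis unfolding dist_def by simp
  qed
  have "hausdorff_dist Z (Inl ` mspace Y) (Inr ` mspace X) \<le> ereal r"
  proof (rule ereal_le_epsilon2)
    fix e :: real assume e: "0 < e"
    have near: "dist (Inl (f x)) (Inr x) < r + e" "dist (Inr x) (Inl (f x)) < r + e"
      if "x \<in> mspace X" for x
      using close[OF that] e W.commute[of "Inr x" "Inl (f x)"] by simp_all
    have sub: "Inl ` mspace Y \<subseteq> mspace Z" "Inr ` mspace X \<subseteq> mspace Z"
      by (auto simp: Z W_def)
    have "Inl ` mspace Y \<subseteq> nbhd Z (r + e) (Inr ` mspace X)"
      unfolding subset_nbhd_iff[OF sub] unfolding Z f[symmetric] using near by blast
    moreover have "Inr ` mspace X \<subseteq> nbhd Z (r + e) (Inl ` mspace Y)"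
      unfolding subset_nbhd_iff[OF sub(2,1)] unfolding Z f[symmetric] using near by blast
    ultimately show "hausdorff_dist Z (Inl ` mspace Y) (Inr ` mspace X) \<le> ereal r + ereal e"
      unfolding hausdorff_dist_def using r e by (intro Inf_lower) auto
  qed
  then show ?thesis
    unfolding gh_dist_def gh_realized_in_def using cX cY by (intro Inf_lower) blast
qed

section \<open>Labellings from Hausdorff-close copies\<close>

text \<open>
  For finite \<open>B\<close> one adds points to \<open>T\<close> until the count is right. For infinite \<open>B\<close> adding a copy of
  \<open>B\<close> to \<open>T\<close> gives the right cardinality, by absorption.
\<close>

lemma intermediate_cardinality:
  assumes TA: "T \<subseteq> A" and TB: "T \<lesssim> B" and BA: "B \<lesssim> A"
  shows "\<exists>T'. T \<subseteq> T' \<and> T' \<subseteq> A \<and> T' \<approx> B"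
proof (cases "finite B")
  case True
  then have fT: "finite T" and cT: "card T \<le> card B"
    using TB True by (auto simp: lepoll_def intro: inj_on_finite card_inj_on_le)
  have "\<exists>T'. T \<subseteq> T' \<and> T' \<subseteq> A \<and> finite T' \<and> card T' = card B"
  proof (cases "finite A")
    case fA: True
    then have "card B \<le> card A" using BA True lepoll_iff_card_le by blast
    from exists_subset_between[OF cT this TA fA] show ?thesis
      using fA finite_subset by blast
  next
    case False
    then have "infinite (A - T)" using fT by simp
    then obtain U where U: "finite U" "card U = card B - card T" "U \<subseteq> A - T"
      by (meson infinite_arbitrarily_large)
    then have "card (T \<union> U) = card B"
      using fT cT by (subst card_Un_disjoint) auto
    then show ?thesis using U fT TA by (intro exI[of _ "T \<union> U"]) auto
  qed
  then show ?thesis using True eqpoll_iff_card by blast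
next
  case False
  obtain j where j: "inj_on j B" "j ` B \<subseteq> A" using BA by (auto simp: lepoll_def)
  have jB: "j ` B \<lesssim> B" "B \<lesssim> j ` B" using j(1) image_lepoll by auto
  have "T \<union> j ` B \<lesssim> B"
    using card_of_Un_ordLeq_infinite_Field[of "card_of B" T "j ` B", OF _ _ _ card_of_Card_order]
      False TB jB(1)
    unfolding lepoll_def card_of_ordLeq Field_card_of by blast
  moreover have "B \<lesssim> T \<union> j ` B"
    using jB(2) by (rule lepoll_trans) (simp add: subset_imp_lepoll)
  ultimately have "T \<union> j ` B \<approx> B" by (rule lepoll_antisym)
  then show ?thesis using j TA by (intro exI[of _ "T \<union> j ` B"]) auto
qed

text \<open>
  This cuts the fibres of \<open>f\<close> into exactly as many parts as \<open>B\<close> has elements. A system of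
  representatives of the fibres is enlarged to a set \<open>T\<close> of the cardinality of \<open>B\<close>. The retraction of
  \<open>A\<close> onto \<open>T\<close> that sends each point outside \<open>T\<close> to the representative of its fibre never leaves a fibre
  of \<open>f\<close>, so its own fibres are the parts wanted.
\<close>

lemma surjection_refining:
  assumes f: "f ` A \<subseteq> B" and BA: "B \<lesssim> A"
  shows "\<exists>s. s ` A = B \<and> (\<forall>x\<in>A. \<forall>y\<in>A. s x = s y \<longrightarrow> f x = f y)"
proof -
  define rep where "rep = inv_into A f"
  have rep: "rep (f x) \<in> A" "f (rep (f x)) = f x" if "x \<in> A" for x
    using that by (simp_all add: rep_def inv_into_into f_inv_into_f)
  have "rep ` f ` A \<lesssim> B"
    using image_lepoll subset_imp_lepoll[OF f] lepoll_trans by blast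
  moreover have "rep ` f ` A \<subseteq> A" using rep by auto
  ultimately obtain T where T: "rep ` f ` A \<subseteq> T" "T \<subseteq> A" "T \<approx> B"
    using intermediate_cardinality BA by metis
  obtain g where g: "bij_betw g T B" using T(3) by (auto simp: eqpoll_def)
  define ret where "ret x = (if x \<in> T then x else rep (f x))" for x
  have f_ret: "f (ret x) = f x" if "x \<in> A" for x using rep[OF that] by (simp add: ret_def)
  have ret_T: "ret ` A = T"
    using T by (auto simp: ret_def image_iff subset_iff)
  have "(g \<circ> ret) ` A = B" using g ret_T by (metis bij_betw_imp_surj_on image_comp)
  moreover have "f x = f y" if "x \<in> A" "y \<in> A" "(g \<circ> ret) x = (g \<circ> ret) y" for x y
  proof -
    have "ret x = ret y"
      using that g ret_T by (auto simp: bij_betw_def inj_on_def)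
    then show ?thesis using f_ret that by metis
  qed
  ultimately show ?thesis by blast
qed

text \<open>
  Points are related if their images in \<open>Z\<close> are closer than \<open>r'\<close>. The strict inequality \<open>r < r'\<close> is
  there because the infimum defining the Hausdorff distance need not be attained.
\<close>

lemma gh_realized_in_correspondence:
  assumes "gh_realized_in Z Y X r" "r < r'"
  shows "\<exists>R. (\<forall>y\<in>mspace Y. \<exists>x\<in>mspace X. R y x) \<and> (\<forall>x\<in>mspace X. \<exists>y\<in>mspace Y. R y x) \<and>
    (\<forall>y\<in>mspace Y. \<forall>y'\<in>mspace Y. \<forall>x\<in>mspace X. \<forall>x'\<in>mspace X. R y x \<longrightarrow> R y' x' \<longrightarrow>
      \<bar>mdist X x x' - mdist Y y y'\<bar> < 2 * r')"
proof -
  obtain Y' X' f g where Y': "Y' \<subseteq> mspace Z" and X': "X' \<subseteq> mspace Z"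
    and f: "bij_betw f (mspace Y) Y'" and g: "bij_betw g (mspace X) X'"
    and fd: "\<forall>y\<in>mspace Y. \<forall>y'\<in>mspace Y. mdist Z (f y) (f y') = mdist Y y y'"
    and gd: "\<forall>x\<in>mspace X. \<forall>x'\<in>mspace X. mdist Z (g x) (g x') = mdist X x x'"
    and H: "hausdorff_dist Z Y' X' \<le> ereal r"
    using assms(1) unfolding gh_realized_in_def isometric_copy_def by blast
  have "hausdorff_dist Z Y' X' < ereal r'" using H assms(2) by (simp add: le_less_trans)
  then obtain t where t: "t < r'" "Y' \<subseteq> nbhd Z t X'" "X' \<subseteq> nbhd Z t Y'"
    unfolding hausdorff_dist_def Inf_less_iff by auto
  define R where "R y x \<longleftrightarrow> mdist Z (f y) (g x) < r'" for y x
  have fY: "f ` mspace Y = Y'" and gX: "g ` mspace X = X'"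
    using f g by (auto simp: bij_betw_def)
  have "\<exists>x\<in>mspace X. R y x" if "y \<in> mspace Y" for y
  proof -
    have "f y \<in> Y'" using that fY by blast
    then obtain z where "z \<in> X'" "mdist Z z (f y) < t"
      using t(2) subset_nbhd_iff[OF Y' X'] by blast
    then show ?thesis using t(1) gX unfolding R_def by (force simp: mdist_commute)
  qed
  moreover have "\<exists>y\<in>mspace Y. R y x" if "x \<in> mspace X" for x
  proof -
    have "g x \<in> X'" using that gX by blast
    then obtain z where "z \<in> Y'" "mdist Z z (g x) < t"
      using t(3) subset_nbhd_iff[OF X' Y'] by blast
    then show ?thesis using t(1) fY unfolding R_def by force
  qed
  moreover have "\<bar>mdist X x x' - mdist Y y y'\<bar> < 2 * r'"
    if m: "y \<in> mspace Y" "y' \<in> mspace Y" "x \<in> mspace X" "x' \<in> mspace X" and R: "R y x" "R y' x'"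
    for y y' x x'
  proof -
    have Zm: "f y \<in> mspace Z" "f y' \<in> mspace Z" "g x \<in> mspace Z" "g x' \<in> mspace Z"
      using m fY gX Y' X' by auto
    have "mdist Z (g x) (g x') \<le> mdist Z (g x) (f y) + mdist Z (f y) (f y') + mdist Z (f y') (g x')"
      using mdist_triangle[of "g x" Z "f y" "g x'"] mdist_triangle[of "f y" Z "f y'" "g x'"] Zm
      by simp
    moreover
    have "mdist Z (f y) (f y') \<le> mdist Z (f y) (g x) + mdist Z (g x) (g x') + mdist Z (g x') (f y')"
      using mdist_triangle[of "f y" Z "g x" "f y'"] mdist_triangle[of "g x" Z "g x'" "f y'"] Zm
      by simp
    ultimately show ?thesis
      using R fd[rule_format, OF m(1,2)] gd[rule_format, OF m(3,4)] unfolding R_def by (simp add: mdist_commute)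
  qed
  ultimately show ?thesis by (intro exI[of _ R]) simp
qed

text \<open>
  The dichotomy on \<open>2 * r' \<le> lam\<close> decides whether the correspondence already is a map onto \<open>S\<close> or is so
  coarse that only the diameters of the fibres matter.
\<close>

lemma surjection_of_gh_realized_in:
  fixes X :: "'a metric" and S :: "'b metric"
  assumes lam: "0 < lam" and S: "simplex_metric lam S" and SX: "mspace S \<lesssim> mspace X"
    and Z: "gh_realized_in Z S X r" and r: "r < r'"
  shows "\<exists>s. s ` mspace X = mspace S \<and> distortion_le X S s (2 * r')"
proof -
  obtain R where RS: "\<forall>t\<in>mspace S. \<exists>x\<in>mspace X. R t x"
    and RX: "\<forall>x\<in>mspace X. \<exists>t\<in>mspace S. R t x"
    and R_all: "\<forall>t\<in>mspace S. \<forall>t'\<in>mspace S. \<forall>x\<in>mspace X. \<forall>x'\<in>mspace X. R t x \<longrightarrow> R t' x' \<longrightarrow>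
      \<bar>mdist X x x' - mdist S t t'\<bar> < 2 * r'"
    using gh_realized_in_correspondence[OF Z r] by (elim exE conjE) (rule that)
  note R = R_all[rule_format]
  obtain q where q_all: "\<forall>x\<in>mspace X. q x \<in> mspace S \<and> R (q x) x"
    using bchoice[of "mspace X" "\<lambda>x t. t \<in> mspace S \<and> R t x"] RX by blast
  then have q: "q x \<in> mspace S" "R (q x) x" if "x \<in> mspace X" for x
    using that by simp_all
  have qR: "\<bar>mdist X x y - mdist S (q x) (q y)\<bar> < 2 * r'"
    if "x \<in> mspace X" "y \<in> mspace X" for x y
    using that by (intro R q)
  show ?thesis
  proof (cases "2 * r' \<le> lam")
    case True
    \<comment> \<open>A point related to \<open>t\<close> cannot have another label, since distinct vertices are \<open>lam\<close> apart.\<close>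
    have "t \<in> q ` mspace X" if t: "t \<in> mspace S" for t
    proof -
      obtain x where x: "x \<in> mspace X" "R t x" using RS t by blast
      have "mdist X x x = 0" using x(1) by simp
      then have "mdist S t (q x) < lam"
        using R[OF t q(1)[OF x(1)] x(1) x(1) x(2) q(2)[OF x(1)]] True by linarith
      then have "t = q x" using simplex_mdist[OF S t q(1)[OF x(1)]] by (auto split: if_splits)
      then show ?thesis using x by blast
    qed
    then have "q ` mspace X = mspace S" using q by blast
    moreover have "distortion_le X S q (2 * r')"
      unfolding distortion_le_def using qR by (simp add: less_imp_le)
    ultimately show ?thesis by blast
  next
    case False
    have "q ` mspace X \<subseteq> mspace S" using q by blast
    obtain s where s: "s ` mspace X = mspace S"
      and sq: "\<And>x y. x \<in> mspace X \<Longrightarrow> y \<in> mspace X \<Longrightarrow> s x = s y \<Longrightarrow> q x = q y"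
      using surjection_refining[OF \<open>q ` mspace X \<subseteq> mspace S\<close> SX] by blast
    have "\<bar>mdist X x y - mdist S (s x) (s y)\<bar> \<le> 2 * r'"
      if xy: "x \<in> mspace X" "y \<in> mspace X" for x y
    proof -
      have sS: "s x \<in> mspace S" "s y \<in> mspace S" using s xy by auto
      note B = qR[OF xy]
      show ?thesis
      proof (cases "s x = s y")
        case True
        have "mdist S (q x) (q y) = 0" "mdist S (s x) (s y) = 0"
          using True sq[OF xy True] sS q(1) xy by simp_all
        then show ?thesis using B by linarith
      next
        case ne: False
        have "mdist S (q x) (q y) \<le> lam" "mdist S (s x) (s y) = lam"
          using simplex_mdist[OF S q(1) q(1)] simplex_mdist[OF S sS] ne xy lam by simp_all
        then show ?thesis
          using B False mdist_nonneg[of X x y] by linarith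
      qed
    qed
    then show ?thesis using s unfolding distortion_le_def by blast
  qed
qed

theorem theorem2p5:
  fixes X :: "'a metric" and S :: "'b metric" and lam :: real
  assumes "Metric_space.mbounded (mspace X) (mdist X) (mspace X)"
    and "0 < lam"
    and "simplex_metric lam S"
    and "mspace S \<noteq> {}"
    and "mspace S \<lesssim> mspace X"
  shows "2 * gh_dist S X =
    max (mdiam X (mspace X) - ereal lam)
        (INF (\<alpha>, d) \<in> Ext (mspace S) X. h_fun \<alpha> d lam)"
    (is "_ = ?rhs")
proof (rule antisym)
  have X: "mspace X \<noteq> {}" using assms(4,5) by auto
  have half: "2 * g < ereal c \<longleftrightarrow> g < ereal (c / 2)" for g c
    by (cases g) (auto simp: numeral_eq_ereal)
  show "2 * gh_dist S X \<le> ?rhs"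
  proof (rule dense_ge)
    fix e assume "?rhs < e"
    then obtain c where c: "?rhs < ereal c" "ereal c < e" using ereal_dense2 by blast
    \<comment> \<open>The distortion may vanish; the slack between \<open>b\<close> and \<open>c\<close> makes the gluing distance positive.\<close>
    obtain b where b: "?rhs < ereal b" "ereal b < ereal c" using c(1) ereal_dense2 by blast
    obtain s where s: "s ` mspace X = mspace S" "distortion_le X S s b"
      using max_INF_Ext_less[OF assms(2,3) b(1)] by blast
    obtain x where x: "x \<in> mspace X" using X by blast
    have "0 \<le> \<bar>mdist X x x - mdist S (s x) (s x)\<bar>" by simp
    also have "\<dots> \<le> b" using s(2) x by (simp add: distortion_le_def)
    also have "b < c" using b(2) by simp
    finally have "0 < c / 2" by simp
    moreover have "distortion_le X S s (2 * (c / 2))"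
      unfolding distortion_le_def
    proof (intro ballI)
      fix x y assume "x \<in> mspace X" "y \<in> mspace X"
      then have "\<bar>mdist X x y - mdist S (s x) (s y)\<bar> \<le> b"
        using s(2) by (simp add: distortion_le_def)
      then show "\<bar>mdist X x y - mdist S (s x) (s y)\<bar> \<le> 2 * (c / 2)" using \<open>b < c\<close> by simp
    qed
    ultimately have "gh_dist S X \<le> ereal (c / 2)"
      using gh_dist_le_of_surjection[OF X s(1)] by blast
    then have "2 * gh_dist S X \<le> ereal c"
      by (cases "gh_dist S X") (auto simp: numeral_eq_ereal)
    then show "2 * gh_dist S X \<le> e" using c(2) by simp
  qed
  show "?rhs \<le> 2 * gh_dist S X"
  proof (rule dense_ge)
    fix e assume e: "2 * gh_dist S X < e"
    then obtain c where c: "2 * gh_dist S X < ereal c" "ereal c < e"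
      using ereal_dense2 by blast
    then have "gh_dist S X < ereal (c / 2)" by (simp only: half)
    then obtain r Z where Z: "gh_realized_in (Z :: ('b + 'a) metric) S X r" "r < c / 2"
      unfolding gh_dist_def Inf_less_iff by auto
    obtain s where "s ` mspace X = mspace S" "distortion_le X S s (2 * (c / 2))"
      using Z surjection_of_gh_realized_in[OF assms(2,3,5)] by blast
    from max_INF_Ext_le[OF assms(2,3) this] have "?rhs \<le> ereal c" by simp
    also have "\<dots> \<le> e" using c(2) by simp
    finally show "?rhs \<le> e" .
  qed
qed

end
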